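(* There exists an even probability measure $\rho$ on $\mathbb{R}$ such that $\mathcal{T}_\rho=(-\infty,\infty)$ and $\mathcal{P}_\rho=\emptyset$.
   Context: For an even probability measure $\rho$ on $\mathbb{R}$ and $\lambda\in\mathbb{R}$, let $H_{\rho,\lambda}(z)=\int_{-\infty}^{\infty} e^{izt}e^{\lambda t^2}\,d\rho(t)$ for $z\in\mathbb{C}$. Define $\mathcal{T}_\rho=\{b\in\mathbb{R}:\int e^{bx^2}\,d\rho(x)<\infty\}$ and $\mathcal{P}_\rho=\{\lambda\in\mathbb{R}: H_{\rho,\lambda}\text{ is entire and all its zeros in }\mathbb{C}\text{ are real}\}$. *)

theory Defs
  imports "HOL-Probability.Probability" "HOL-Complex_Analysis.Complex_Analysis"
begin

definition even_prob_measure :: "real measure \<Rightarrow> bool" where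
  "even_prob_measure \<rho> \<longleftrightarrow>
     prob_space \<rho> \<and> sets \<rho> = sets borel \<and>
     (\<forall>A\<in>sets borel. emeasure \<rho> (uminus ` A) = emeasure \<rho> A)"

definition H_integrand :: "real \<Rightarrow> complex \<Rightarrow> real \<Rightarrow> complex" where
  "H_integrand l z t = exp (\<i> * z * of_real t) * of_real (exp (l * t\<^sup>2))"

definition H :: "real measure \<Rightarrow> real \<Rightarrow> complex \<Rightarrow> complex" where
  "H \<rho> l z = (LINT t|\<rho>. H_integrand l z t)"

definition T_set :: "real measure \<Rightarrow> real set" where
  "T_set \<rho> = {b. integrable \<rho> (\<lambda>x. exp (b * x\<^sup>2))}"

text \<open>The integrability condition is part of H being entire: the integral must converge at every
  point, whereas the library's Bochner integral takes the value 0 on non-integrable functions.\<close>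

definition P_set :: "real measure \<Rightarrow> real set" where
  "P_set \<rho> = {l. (\<forall>z. integrable \<rho> (H_integrand l z)) \<and>
                 H \<rho> l holomorphic_on UNIV \<and>
                 (\<forall>z. H \<rho> l z = 0 \<longrightarrow> z \<in> \<real>)}"

end

theory Submission imports Defs begin

text \<open>The measure is the discrete one giving each integer \<open>k\<close> a mass proportional to
  \<open>exp (-k^4)\<close>. On the line \<open>Re z = \<pi>\<close> the function \<open>H \<rho> \<lambda>\<close> is real, being up to a constant
  the alternating series of the \<open>(-1)^k exp (-k^4 + \<lambda> k^2 + k y)\<close> with \<open>z = \<pi> - \<i> y\<close>.
  For large \<open>n\<close> the choice \<open>y = 4 n^3 - 2 \<lambda> n > 0\<close> makes the term \<open>k = n\<close> outweigh all the
  others together, so \<open>H \<rho> \<lambda>\<close> has the sign of \<open>(-1)^n\<close> there. By the intermediate value theorem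
  there is a zero off the real axis.\<close>

section \<open>Two-sided geometric sums over the integers\<close>

text \<open>What matters about 9/7 is that it is below 2: the terms away from the centre add up to
  2/7, less than the central term 1.\<close>

lemma has_bochner_integral_two_sided_geometric:
  "has_bochner_integral (count_space (UNIV::int set)) (\<lambda>k. (1/8::real) ^ nat \<bar>k\<bar>) (9/7)"
proof -
  let ?g = "\<lambda>k::int. (1/8::real) ^ nat \<bar>k\<bar>"
  have pos: "(?g has_sum (8/7)) (range int)"
  proof (subst has_sum_reindex)
    have "(\<lambda>n. (1/8::real) ^ n) sums (8/7)"
      using geometric_sums[of "1/8::real"] by simp
    thus "(?g \<circ> int has_sum (8/7)) UNIV"
      by (simp add: o_def sums_nonneg_imp_has_sum)
  qed simp
  \<comment> \<open>The shift by \<open>Suc\<close> leaves 0 to the first half only, so this half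
    starts at 1/8.\<close>
  have neg: "(?g has_sum (1/7)) (range (\<lambda>n. - int (Suc n)))"
  proof (subst has_sum_reindex)
    have "(\<lambda>n. (1/8::real) ^ n) sums (8/7)"
      using geometric_sums[of "1/8::real"] by simp
    hence "(\<lambda>n. (1/8::real) * (1/8::real) ^ n) sums (1/8 * (8/7))"
      by (rule sums_mult)
    hence "(\<lambda>n. (1/8::real) ^ Suc n) sums (1/7)"
      by simp
    hence "((\<lambda>n. (1/8::real) ^ Suc n) has_sum (1/7)) UNIV"
      by (rule sums_nonneg_imp_has_sum) simp
    moreover have "nat \<bar>- int (Suc n)\<bar> = Suc n" for n
      by simp
    ultimately show "(?g \<circ> (\<lambda>n. - int (Suc n)) has_sum (1/7)) UNIV"
      by (simp only: o_def)
  qed (auto simp: inj_on_def)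
  have un: "range int \<union> range (\<lambda>n. - int (Suc n)) = (UNIV::int set)"
  proof (intro equalityI subsetI UNIV_I)
    fix k :: int
    show "k \<in> range int \<union> range (\<lambda>n. - int (Suc n))"
      by (cases k) auto
  qed
  have "(?g has_sum (8/7 + 1/7)) (range int \<union> range (\<lambda>n. - int (Suc n)))"
    by (rule has_sum_Un_disjoint[OF pos neg]) auto
  hence hs: "(?g has_sum (9/7)) UNIV"
    unfolding un by simp
  hence "?g summable_on UNIV"
    using has_sum_imp_summable by blast
  hence int: "integrable (count_space UNIV) ?g"
    using abs_summable_equivalent[of ?g UNIV]
    by (simp add: Infinite_Set_Sum.abs_summable_on_def)
  moreover have "integral\<^sup>L (count_space UNIV) ?g = 9/7"
    using infsetsum_infsum[of ?g UNIV] int infsumI[OF hs]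
    by (simp add: infsetsum_def Infinite_Set_Sum.abs_summable_on_def)
  ultimately show ?thesis
    by (simp add: has_bochner_integral_iff)
qed

lemma has_bochner_integral_geometric_centered:
  "has_bochner_integral (count_space (UNIV::int set)) (\<lambda>k. (1/8::real) ^ nat \<bar>k - n\<bar>) (9/7)"
proof -
  have bij: "bij_betw (\<lambda>k::int. k - n) UNIV UNIV"
    by (rule bij_betwI[where g = "\<lambda>k. k + n"]) auto
  have "has_bochner_integral (distr (count_space UNIV) (count_space UNIV) (\<lambda>k. k - n))
          (\<lambda>k. (1/8::real) ^ nat \<bar>k\<bar>) (9/7)"
    using has_bochner_integral_two_sided_geometric distr_bij_count_space[OF bij] by simp
  thus ?thesis
    by (simp add: has_bochner_integral_iff integrable_distr_eq integral_distr)
qed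

lemma has_bochner_integral_count_space_singleton:
  "has_bochner_integral (count_space UNIV) (indicator {a} :: 'a \<Rightarrow> real) 1"
  using has_bochner_integral_real_indicator[of "{a}" "count_space UNIV"] by simp

section \<open>Exponents of the terms and dominance of a single term\<close>

definition expo :: "real \<Rightarrow> real \<Rightarrow> int \<Rightarrow> real" where
  "expo l y k = l * of_int k ^ 2 + of_int k * y - of_int k ^ 4"

text \<open>The value of \<open>y\<close> at which the derivative of \<open>expo l y k\<close> in
  \<open>k\<close> vanishes at \<open>k = n\<close>.\<close>

definition crit :: "real \<Rightarrow> int \<Rightarrow> real" where
  "crit l n = 4 * of_int n ^ 3 - 2 * l * of_int n"

text \<open>As \<open>n\<close> is a critical point, the difference is a quartic in \<open>k\<close>
  with a double root at \<open>n\<close>; the other factor is what remains, with the square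
  completed.\<close>

lemma expo_crit_diff:
  "expo l (crit l n) k - expo l (crit l n) n =
     - (of_int (k - n))\<^sup>2 * ((of_int (k + n))\<^sup>2 + (2 * of_int n ^ 2 - l))"
  unfolding expo_def crit_def by (simp add: algebra_simps power2_eq_square power3_eq_cube power4_eq_xxxx)

text \<open>The second factor in \<open>expo_crit_diff\<close> is at least \<open>ln 8\<close>, and
  a natural number is at most its square, so each unit of distance from \<open>n\<close> costs at
  least a factor 8.\<close>

lemma exp_expo_crit_le:
  assumes "2 * of_int n ^ 2 - l \<ge> ln 8"
  shows "exp (expo l (crit l n) k) \<le> exp (expo l (crit l n) n) * (1/8) ^ nat \<bar>k - n\<bar>"
proof -
  define m where "m = nat \<bar>k - n\<bar>"
  have m: "(of_int (k - n))\<^sup>2 = real m ^ 2"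
    unfolding m_def by simp
  have "real m * ln 8 \<le> real m ^ 2 * ln 8"
  proof (rule mult_right_mono)
    show "real m \<le> real m ^ 2"
      by (cases m) (auto simp: power2_eq_square algebra_simps)
  qed simp
  also have "\<dots> \<le> real m ^ 2 * ((of_int (k + n))\<^sup>2 + (2 * of_int n ^ 2 - l))"
    using assms by (intro mult_left_mono) (auto intro: add_increasing)
  finally have "expo l (crit l n) k \<le> expo l (crit l n) n - real m * ln 8"
    using expo_crit_diff[of l n k] unfolding m by simp
  hence "exp (expo l (crit l n) k) \<le> exp (expo l (crit l n) n - real m * ln 8)"
    by simp
  also have "\<dots> = exp (expo l (crit l n) n) * (1/8) ^ m"
    by (simp add: exp_diff exp_of_nat_mult power_one_over field_simps)
  finally show ?thesis
    unfolding m_def .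
qed

lemma exists_large_square: "\<exists>n::int. n \<ge> 0 \<and> 2 * real_of_int n ^ 2 \<ge> c"
proof (intro exI conjI)
  \<comment> \<open>Adding 1 ensures \<open>?n >= 1\<close>, so that squaring does not decrease
    it.\<close>
  let ?n = "\<lceil>\<bar>c\<bar>\<rceil> + 1"
  show "?n \<ge> 0" by simp
  have a: "real_of_int ?n \<ge> \<bar>c\<bar>" "real_of_int ?n \<ge> 1" by linarith+
  hence "real_of_int ?n ^ 2 \<ge> real_of_int ?n"
    by (intro self_le_power) auto
  thus "2 * real_of_int ?n ^ 2 \<ge> c"
    using a by linarith
qed

lemma integrable_exp_expo: "integrable (count_space UNIV) (\<lambda>k. exp (expo l y k))"
proof -
  \<comment> \<open>Raising \<open>l\<close> by \<open>\<bar>y\<bar>\<close> absorbs the linear term; for each \<open>k\<close> one of the linear terms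
    \<open>\<plusminus> k * crit l' n\<close> is nonnegative, so the sum of the two centered bounds dominates.\<close>
  define l' where "l' = l + \<bar>y\<bar>"
  obtain n :: int where n: "2 * real_of_int n ^ 2 \<ge> l' + ln 8"
    using exists_large_square by blast
  let ?C = "exp (expo l' (crit l' n) n)" and ?D = "exp (expo l' (crit l' (-n)) (-n))"
  let ?h = "\<lambda>k. ?C * (1/8::real) ^ nat \<bar>k - n\<bar> + ?D * (1/8) ^ nat \<bar>k - (-n)\<bar>"
  have l'n: "2 * real_of_int n ^ 2 - l' \<ge> ln 8" "2 * real_of_int (-n) ^ 2 - l' \<ge> ln 8"
    using n by auto
  have "integrable (count_space UNIV) ?h"
    using has_bochner_integral_geometric_centered[of n]
          has_bochner_integral_geometric_centered[of "-n"]
    by (intro Bochner_Integration.integrable_add integrable_mult_right)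
       (auto simp: has_bochner_integral_iff)
  thus ?thesis
  proof (rule Bochner_Integration.integrable_bound)
    have "exp (expo l y k) \<le> ?h k" for k
    proof -
      have C: "?C * (1/8) ^ nat \<bar>k - n\<bar> \<ge> 0" and D: "?D * (1/8) ^ nat \<bar>k - (-n)\<bar> \<ge> 0"
        by simp_all
      have "of_int k * y \<le> \<bar>of_int k\<bar> * \<bar>y\<bar>"
        by (metis abs_ge_self abs_mult)
      also have "\<dots> \<le> of_int k ^ 2 * \<bar>y\<bar>"
      proof (intro mult_right_mono)
        have "\<bar>k\<bar> \<le> k ^ 2"
          using self_le_power[of "\<bar>k\<bar>" 2] by (cases "k = 0") auto
        thus "\<bar>real_of_int k\<bar> \<le> of_int k ^ 2"
          by (metis of_int_abs of_int_le_iff of_int_power)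
      qed simp
      finally have le: "expo l y k \<le> expo l' 0 k"
        unfolding expo_def l'_def by (simp add: algebra_simps)
      have "crit l' (-n) = - crit l' n"
        by (simp add: crit_def)
      hence "expo l' 0 k \<le> expo l' (crit l' n) k \<or> expo l' 0 k \<le> expo l' (crit l' (-n)) k"
        by (auto simp: expo_def)
      hence "exp (expo l y k) \<le> exp (expo l' (crit l' n) k) \<or>
             exp (expo l y k) \<le> exp (expo l' (crit l' (-n)) k)"
        using le by auto
      thus ?thesis
        using exp_expo_crit_le[OF l'n(1), of k] exp_expo_crit_le[OF l'n(2), of k] C D by linarith
    qed
    thus "AE k in count_space UNIV. norm (exp (expo l y k)) \<le> norm (?h k)"
      by (auto intro!: AE_I2)
  qed simp
qed

lemma alternating_integral_sign:
  assumes "2 * of_int n ^ 2 - l \<ge> ln 8"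
  shows "(\<integral>k. cos (pi * of_int k) * exp (expo l (crit l n) k) \<partial>count_space UNIV)
           * cos (pi * of_int n) > 0"
proof -
  let ?c = "exp (expo l (crit l n) n)"
  let ?f = "\<lambda>k::int. cos (pi * of_int k) * exp (expo l (crit l n) k)"
  \<comment> \<open>A lower bound for the signed terms: \<open>?c\<close> at \<open>k = n\<close>,
    where the sign squares to 1, and the worst case
    \<open>- ?c * (1/8) ^ nat \<bar>k - n\<bar>\<close> elsewhere. The coefficient 2 makes up for
    the central term being subtracted as well.\<close>
  let ?h = "\<lambda>k::int. ?c * (2 * indicator {n} k - (1/8::real) ^ nat \<bar>k - n\<bar>)"
  have g: "integrable (count_space UNIV) (\<lambda>k. (1/8::real) ^ nat \<bar>k - n\<bar>)"
          "(\<integral>k. (1/8::real) ^ nat \<bar>k - n\<bar> \<partial>count_space UNIV) = 9/7"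
    using has_bochner_integral_geometric_centered[of n] by (auto simp: has_bochner_integral_iff)
  have ind: "has_bochner_integral (count_space UNIV) (indicator {n} :: int \<Rightarrow> real) 1"
    by (rule has_bochner_integral_count_space_singleton)
  have ind': "integrable (count_space UNIV) (\<lambda>k. 2 * indicator {n} k :: real)"
             "(\<integral>k. 2 * indicator {n} k \<partial>count_space UNIV) = (2::real)"
    using ind by (auto simp: has_bochner_integral_iff)
  have "0 < ?c * (2 - 9/7)"
    by simp
  also have "\<dots> = (\<integral>k. ?h k \<partial>count_space UNIV)"
    using g ind' by simp
  also have "\<dots> \<le> (\<integral>k. ?f k * cos (pi * of_int n) \<partial>count_space UNIV)"
  proof (rule integral_mono)
    show "integrable (count_space UNIV) ?h"
      by (intro integrable_mult_right Bochner_Integration.integrable_diff g ind')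
    have "integrable (count_space UNIV) ?f"
      by (rule Bochner_Integration.integrable_bound[OF integrable_exp_expo[of l "crit l n"]])
         (auto simp: abs_mult intro!: AE_I2 mult_left_le_one_le)
    thus "integrable (count_space UNIV) (\<lambda>k. ?f k * cos (pi * of_int n))"
      by (rule integrable_mult_left)
  next
    fix k :: int
    show "?h k \<le> ?f k * cos (pi * of_int n)"
    proof (cases "k = n")
      case True
      have "sin (pi * real_of_int n) = 0"
        by (metis mult.commute sin_npi_int)
      hence "cos (pi * real_of_int n) * cos (pi * real_of_int n) = 1"
        using sin_cos_squared_add[of "pi * real_of_int n"] by (simp add: power2_eq_square)
      thus ?thesis
        using True by (simp add: mult.commute mult.left_commute)
    next
      case False
      let ?s = "cos (pi * of_int k) * cos (pi * of_int n)"
      have "\<bar>?s\<bar> \<le> 1"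
        unfolding abs_mult by (intro mult_le_one abs_cos_le_one abs_ge_zero)
      hence "(-1) * exp (expo l (crit l n) k) \<le> ?s * exp (expo l (crit l n) k)"
        by (intro mult_right_mono) auto
      thus ?thesis
        using False exp_expo_crit_le[OF assms, of k] by (simp add: mult.commute mult.left_commute)
    qed
  qed
  finally show ?thesis
    by simp
qed

section \<open>The measure, its evenness and its Gaussian moments\<close>

definition quartic_norm :: real where
  "quartic_norm = (\<integral>k. exp (- (of_int k ^ 4)) \<partial>count_space (UNIV::int set))"

definition quartic_mass :: "int \<Rightarrow> real" where
  "quartic_mass k = exp (- (of_int k ^ 4)) / quartic_norm"

text \<open>Placing the weights on \<open>int\<close> first lets integrals against
  \<open>quartic\<close> be pulled back to integrals over counting measure.\<close>

definition quartic_weights :: "int measure" where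
  "quartic_weights = density (count_space UNIV) (\<lambda>k. ennreal (quartic_mass k))"

definition quartic :: "real measure" where
  "quartic = distr quartic_weights borel of_int"

lemma quartic_norm_pos: "quartic_norm > 0"
proof -
  have int: "integrable (count_space UNIV) (\<lambda>k::int. exp (- (real_of_int k ^ 4)))"
    using integrable_exp_expo[of 0 0] by (simp add: expo_def)
  \<comment> \<open>The term \<open>k = 0\<close> alone contributes 1 to
    \<open>quartic_norm\<close>.\<close>
  have "(1::real) = (\<integral>k. indicator {0} k \<partial>count_space (UNIV::int set))"
    using has_bochner_integral_count_space_singleton[of "0::int"]
    by (simp add: has_bochner_integral_iff)
  also have "\<dots> \<le> quartic_norm"
    unfolding quartic_norm_def
  proof (rule integral_mono[OF _ int])
    show "integrable (count_space UNIV) (indicator {0} :: int \<Rightarrow> real)"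
      using has_bochner_integral_count_space_singleton[of "0::int"]
      by (simp add: has_bochner_integral_iff)
  qed (auto simp: indicator_def)
  finally show ?thesis by simp
qed

lemma quartic_mass_nonneg: "quartic_mass k \<ge> 0"
  using quartic_norm_pos by (simp add: quartic_mass_def)

lemma of_int_measurable_quartic_weights: "of_int \<in> quartic_weights \<rightarrow>\<^sub>M (borel :: real measure)"
  by (simp add: quartic_weights_def)

lemma prob_space_quartic: "prob_space quartic"
  unfolding quartic_def
proof (rule prob_space.prob_space_distr[OF _ of_int_measurable_quartic_weights], rule prob_spaceI)
  have int: "integrable (count_space UNIV) (\<lambda>k::int. exp (- (real_of_int k ^ 4)))"
    using integrable_exp_expo[of 0 0] by (simp add: expo_def)
  have "(\<integral>\<^sup>+k. ennreal (quartic_mass k) \<partial>count_space UNIV) =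
          ennreal (\<integral>k. quartic_mass k \<partial>count_space UNIV)"
    using int by (intro nn_integral_eq_integral) (auto simp: quartic_mass_nonneg, simp add: quartic_mass_def)
  also have "(\<integral>k. quartic_mass k \<partial>count_space UNIV) = 1"
    using quartic_norm_pos by (simp add: quartic_mass_def quartic_norm_def)
  finally show "emeasure quartic_weights (space quartic_weights) = 1"
    by (simp add: quartic_weights_def emeasure_density)
qed

lemma even_quartic: "even_prob_measure quartic"
  unfolding even_prob_measure_def
proof (intro conjI ballI prob_space_quartic)
  show "sets quartic = sets borel"
    by (simp add: quartic_def)
  fix A :: "real set" assume A: "A \<in> sets borel"
  have em: "emeasure quartic B =
      (\<integral>\<^sup>+k. ennreal (quartic_mass k) * indicator B (real_of_int k) \<partial>count_space UNIV)"
    if "B \<in> sets borel" for B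
    unfolding quartic_def
    by (subst emeasure_distr[OF of_int_measurable_quartic_weights that])
       (auto simp: quartic_weights_def emeasure_density indicator_def intro!: nn_integral_cong)
  have "uminus ` A = uminus -` A \<inter> space borel"
    by (auto simp: image_iff) (metis minus_minus)
  hence mA: "uminus ` A \<in> sets borel"
    using measurable_sets[OF borel_measurable_uminus[OF measurable_ident_sets[OF refl]], of A] A
    by simp
  \<comment> \<open>Evenness is the substitution of \<open>-k\<close> for \<open>k\<close>, which
    preserves the fourth power.\<close>
  have "bij_betw uminus (UNIV::int set) UNIV"
    by (rule bij_uminus)
  hence "emeasure quartic (uminus ` A) =
     (\<integral>\<^sup>+k. ennreal (quartic_mass (-k)) * indicator (uminus ` A) (real_of_int (-k)) \<partial>count_space UNIV)"
    unfolding em[OF mA] by (rule nn_integral_bij_count_space[symmetric])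
  also have "\<dots> = (\<integral>\<^sup>+k. ennreal (quartic_mass k) * indicator A (real_of_int k) \<partial>count_space UNIV)"
    by (intro nn_integral_cong) (auto simp: quartic_mass_def indicator_def image_iff)
  finally show "emeasure quartic (uminus ` A) = emeasure quartic A"
    using em[OF A] by simp
qed

text \<open>Quartic decay beats any quadratic growth: this is \<open>integrable_exp_expo\<close>
  with \<open>y = 0\<close>.\<close>

lemma T_set_quartic: "T_set quartic = UNIV"
proof -
  have "integrable quartic (\<lambda>x. exp (b * x\<^sup>2))" for b
  proof -
    have "integrable (count_space UNIV) (\<lambda>k. exp (expo b 0 k) / quartic_norm)"
      using integrable_exp_expo[of b 0] by simp
    also have "(\<lambda>k. exp (expo b 0 k) / quartic_norm) =
        (\<lambda>k. quartic_mass k *\<^sub>R exp (b * (real_of_int k)\<^sup>2))"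
      by (auto simp: quartic_mass_def expo_def simp flip: exp_add)
    finally have "integrable quartic_weights (\<lambda>k. exp (b * (real_of_int k)\<^sup>2))"
      unfolding quartic_weights_def
      by (subst integrable_density) (auto simp: quartic_mass_nonneg)
    thus ?thesis
      unfolding quartic_def by (subst integrable_distr_eq[OF of_int_measurable_quartic_weights]) auto
  qed
  thus ?thesis
    by (auto simp: T_set_def)
qed

section \<open>Sign changes on a vertical line and a nonreal zero\<close>

text \<open>At this point the factor \<open>exp (\<i> * z * k)\<close> has modulus
  \<open>exp (k * y)\<close> and argument \<open>pi * k\<close>, whose sine vanishes at integers
  \<open>k\<close>.\<close>

lemma H_quartic_vertical_line:
  "H quartic l (Complex pi (- y)) =
     of_real ((\<integral>k. cos (pi * of_int k) * exp (expo l y k) \<partial>count_space UNIV) / quartic_norm)"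
proof -
  have integrand: "quartic_mass k *\<^sub>R H_integrand l (Complex pi (- y)) (of_int k) =
      complex_of_real (cos (pi * of_int k) * exp (expo l y k) / quartic_norm)" for k
  proof -
    have "\<i> * Complex pi (- y) * complex_of_real (of_int k) = Complex (of_int k * y) (pi * of_int k)"
      by (simp add: complex_eq_iff)
    moreover have "sin (pi * real_of_int k) = 0"
      by (metis mult.commute sin_npi_int)
    ultimately have "exp (\<i> * Complex pi (- y) * complex_of_real (of_int k)) =
        complex_of_real (exp (of_int k * y) * cos (pi * of_int k))"
      by (simp add: complex_eq_iff Re_exp Im_exp)
    thus ?thesis
      unfolding H_integrand_def quartic_mass_def expo_def scaleR_conv_of_real
      by (simp only: flip: of_real_mult)
         (simp add: exp_diff exp_add exp_minus field_simps)
  qed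
  have "H quartic l (Complex pi (- y)) =
     (\<integral>k. H_integrand l (Complex pi (- y)) (of_int k) \<partial>quartic_weights)"
    unfolding H_def quartic_def
    by (rule integral_distr[OF of_int_measurable_quartic_weights]) (unfold H_integrand_def[abs_def], measurable)
  also have "\<dots> = (\<integral>k. complex_of_real (cos (pi * of_int k) * exp (expo l y k) / quartic_norm)
      \<partial>count_space UNIV)"
    unfolding quartic_weights_def
    by (subst integral_density) (auto simp: quartic_mass_nonneg integrand)
  finally show ?thesis
    by (simp only: integral_complex_of_real integral_divide_zero)
qed

lemma nonreal_zero_quartic:
  assumes "H quartic l holomorphic_on UNIV"
  shows "\<exists>z. H quartic l z = 0 \<and> z \<notin> \<real>"
proof -
  define S where
    "S y = (\<integral>k. cos (pi * of_int k) * exp (expo l y k) \<partial>count_space UNIV)" for y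
  have H_S: "H quartic l (Complex pi (- y)) = of_real (S y / quartic_norm)" for y
    unfolding S_def by (rule H_quartic_vertical_line)
  \<comment> \<open>Holomorphy yields the continuity of \<open>S\<close> needed for the intermediate
    value argument.\<close>
  have "continuous_on UNIV (\<lambda>y. H quartic l (Complex pi (- y)))"
    by (rule continuous_on_compose2[OF holomorphic_on_imp_continuous_on[OF assms]])
       (auto simp: Complex_eq intro!: continuous_intros)
  hence "continuous_on UNIV (\<lambda>y. Re (H quartic l (Complex pi (- y))) * quartic_norm)"
    by (intro continuous_intros)
  hence cont: "continuous_on UNIV S"
    using quartic_norm_pos by (simp add: H_S)
  obtain m :: int where m: "m \<ge> 0" "2 * real_of_int m ^ 2 \<ge> l + ln 8"
    using exists_large_square by blast
  \<comment> \<open>Even, so that \<open>n\<close> and \<open>n + 1\<close> give opposite signs; at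
    least \<open>m\<close>, so that both are large enough; and positive even when
    \<open>m = 0\<close>.\<close>
  define n where "n = 2 * m + 2"
  have large: "2 * real_of_int k ^ 2 - l \<ge> ln 8" if "k \<ge> m" for k
  proof -
    have "real_of_int m ^ 2 \<le> real_of_int k ^ 2"
      using m that by (intro power_mono) auto
    thus ?thesis
      using m(2) by linarith
  qed
  \<comment> \<open>Positivity keeps the sign change within \<open>y > 0\<close>, so the zero found
    has nonzero imaginary part. It follows from the factorization of \<open>crit l k\<close> as
    \<open>2 * k * (2 * k^2 - l)\<close>.\<close>
  have pos: "crit l k > 0" if "k \<ge> m" "k > 0" for k
  proof -
    have "2 * real_of_int k ^ 2 - l > 0"
      using large[OF that(1)] ln_gt_zero[of "8::real"] by linarith
    hence "0 < 2 * real_of_int k * (2 * real_of_int k ^ 2 - l)"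
      using that(2) by (intro mult_pos_pos) auto
    thus ?thesis
      by (simp add: crit_def algebra_simps power2_eq_square power3_eq_cube)
  qed
  have cosn: "cos (pi * real_of_int n) = 1"
    using cos_int_2pin[of "m + 1"] by (simp add: n_def algebra_simps)
  hence cosn1: "cos (pi * real_of_int (n + 1)) = -1"
    by (simp add: distrib_left)
  have "S (crit l n) > 0" "S (crit l (n + 1)) < 0"
    using alternating_integral_sign[OF large[of n]] alternating_integral_sign[OF large[of "n + 1"]]
      m(1) cosn cosn1 by (auto simp: n_def S_def)
  moreover have "connected (S ` {0<..})"
    using cont by (intro connected_continuous_image continuous_on_subset[OF cont]) auto
  moreover have "crit l n > 0" "crit l (n + 1) > 0"
    using pos[of n] pos[of "n + 1"] m(1) by (auto simp: n_def)
  ultimately have "0 \<in> S ` {0<..}"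
    by (meson connectedD_interval greaterThan_iff imageI less_imp_le)
  then obtain y where "y > 0" "S y = 0"
    by auto
  thus ?thesis
    using H_S[of y] by (intro exI[of _ "Complex pi (- y)"]) (auto simp: complex_is_Real_iff)
qed

theorem mainTheorem3:
  "\<exists>\<rho>::real measure. even_prob_measure \<rho> \<and> T_set \<rho> = UNIV \<and> P_set \<rho> = {}"
proof -
  have "P_set quartic = {}"
    using nonreal_zero_quartic by (auto simp: P_set_def)
  thus ?thesis
    using even_quartic T_set_quartic by blast
qed

end
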